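(* Let $p$ be a positive integer and let $M_0^*,\dots,M_{p-1}^*>1$. Let $$f(z)=\prod_{k=0}^{p-1}\big(a_k(z)\big)^{\bar z^k}$$ be a log-$p$-analytic function in $U$ satisfying $f(0)=\lambda_f(0)=1$. Suppose that for each $k\in\{0,1,\dots,p-1\}$: (i) $a_k$ is log-analytic in $U$, $a_k(0)=a_k'(0)=1$, and $A_k(z):=\log a_k(z)$; (ii) $|a_k(z)|\le M_k^*$ for all $z\in U$. Put $M_k=\log M_k^*+\pi$, let $\rho_3$ be the unique root in $(0,1)$ of the equation $$1-\sum_{k=0}^{p-1}\Big(M_k-\frac1{M_k}\Big)\frac{r^{k+1}\big(2-r+k(1-r)\big)}{(1-r)^2}-\sum_{k=1}^{p-1}(k+1)r^k=0,$$ and let $$\sigma_3=\rho_3-\rho_3^2\Big(\frac{1-\rho_3^{p-1}}{1-\rho_3}\Big)-\sum_{k=0}^{p-1}\Big(M_k-\frac1{M_k}\Big)\frac{\rho_3^{k+2}}{1-\rho_3}.$$ Then $f$ is univalent in $U_{\rho_3}$, and the range $f(U_{\rho_3})$ contains the schlicht disk $U(w_3,r_3)$, where $$w_3=\cosh\sigma_3,\qquad r_3=\sinh\sigma_3.$$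
   Context: For $r>0$, $U_r=\{z\in\mathbb C:|z|<r\}$, $U=U_1$, and $U(w,r)=\{\zeta\in\mathbb C:|\zeta-w|<r\}$. A continuous complex-valued function $F$ on a domain $D$ is poly-analytic of order $p$ if $\partial^pF/\partial\bar z^p=0$ in $D$. A function $f$ is log-$p$-analytic in $D$ if $\log f$ is poly-analytic of order $p$ in $D$; log-analytic means log-$1$-analytic (i.e. $\log f$ is analytic). Here $\log$ is the principal branch, with $\log 1=0$. The power is $(a_k(z))^{\bar z^k}=\exp(\bar z^k\log a_k(z))$, so $\log f=\sum_{k=0}^{p-1}\bar z^kA_k$. For a continuously differentiable $f$, $\lambda_f(z)=\big||f_z(z)|-|f_{\bar z}(z)|\big|$. Univalent means injective. A schlicht disk in $f(U_\rho)$ is a disk that is the univalent image under $f$ of some region in $U_\rho$. Empty sums are $0$. *)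

theory Defs
  imports "HOL-Complex_Analysis.Complex_Analysis"
begin

definition is_domain :: "complex set \<Rightarrow> bool" where
  "is_domain D \<longleftrightarrow> open D \<and> connected D \<and> D \<noteq> {}"

(* The Frechet derivative is the real-linear one: its values at 1 and \<i> are the
   partial derivatives with respect to x and y, where z = x + \<i> y. *)

definition wirtinger_dz :: "(complex \<Rightarrow> complex) \<Rightarrow> complex \<Rightarrow> complex" where
  "wirtinger_dz f z =
     (frechet_derivative f (at z) 1 - \<i> * frechet_derivative f (at z) \<i>) / 2"

definition wirtinger_dbar :: "(complex \<Rightarrow> complex) \<Rightarrow> complex \<Rightarrow> complex" where
  "wirtinger_dbar f z =
     (frechet_derivative f (at z) 1 + \<i> * frechet_derivative f (at z) \<i>) / 2"

definition lambda_min :: "(complex \<Rightarrow> complex) \<Rightarrow> complex \<Rightarrow> real" where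
  "lambda_min f z = \<bar>norm (wirtinger_dz f z) - norm (wirtinger_dbar f z)\<bar>"

(* frechet_derivative is unspecified at points of non-differentiability, so the existence
   of each derivative entering the p-th iterate is required explicitly. *)

definition poly_analytic_on :: "nat \<Rightarrow> (complex \<Rightarrow> complex) \<Rightarrow> complex set \<Rightarrow> bool" where
  "poly_analytic_on p F D \<longleftrightarrow>
     is_domain D \<and> continuous_on D F \<and>
     (\<forall>j<p. \<forall>z\<in>D. ((wirtinger_dbar ^^ j) F) differentiable (at z)) \<and>
     (\<forall>z\<in>D. (wirtinger_dbar ^^ p) F z = 0)"

(* Ln is the principal branch; f must be nonzero because Ln 0 = 0 by convention. *)

definition log_poly_analytic_on :: "nat \<Rightarrow> (complex \<Rightarrow> complex) \<Rightarrow> complex set \<Rightarrow> bool" where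
  "log_poly_analytic_on p f D \<longleftrightarrow>
     (\<forall>z\<in>D. f z \<noteq> 0) \<and> poly_analytic_on p (\<lambda>z. Ln (f z)) D"

definition log_analytic_on :: "(complex \<Rightarrow> complex) \<Rightarrow> complex set \<Rightarrow> bool" where
  "log_analytic_on f D \<longleftrightarrow> log_poly_analytic_on 1 f D"

definition contains_schlicht_disk ::
  "(complex \<Rightarrow> complex) \<Rightarrow> complex set \<Rightarrow> complex \<Rightarrow> real \<Rightarrow> bool" where
  "contains_schlicht_disk f S w r \<longleftrightarrow>
     r > 0 \<and> (\<exists>G. is_domain G \<and> G \<subseteq> S \<and> inj_on f G \<and> f ` G = ball w r)"

definition rho_fun :: "nat \<Rightarrow> (nat \<Rightarrow> real) \<Rightarrow> real \<Rightarrow> real" where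
  "rho_fun p M r =
     1 - (\<Sum>k=0..p-1. (M k - 1 / M k) * (r ^ (k+1) * (2 - r + real k * (1 - r)) / (1 - r)\<^sup>2))
       - (\<Sum>k=1..p-1. (real k + 1) * r ^ k)"

definition sigma_fun :: "nat \<Rightarrow> (nat \<Rightarrow> real) \<Rightarrow> real \<Rightarrow> real" where
  "sigma_fun p M r =
     r - r\<^sup>2 * ((1 - r ^ (p-1)) / (1 - r))
       - (\<Sum>k=0..p-1. (M k - 1 / M k) * (r ^ (k+2) / (1 - r)))"

end

theory Submission
  imports Defs
begin

text \<open>
  Write \<open>F = (\<Sum>k<p. cnj z ^ k * A\<^sub>k)\<close> with \<open>A\<^sub>k = Ln a\<^sub>k\<close>, so that \<open>f = exp F\<close>. The Taylor coefficients of
  \<open>A\<^sub>k\<close> are at most \<open>M\<^sub>k - 1 / M\<^sub>k\<close>; comparing \<open>F\<close> termwise with \<open>z\<close> then gives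
  \<open>\<bar>F z - F w\<bar> \<ge> rho_fun p M R * \<bar>z - w\<bar>\<close> for \<open>\<bar>z\<bar>, \<bar>w\<bar> \<le> R\<close> and \<open>\<bar>F z\<bar> \<ge> sigma_fun p M \<bar>z\<bar>\<close>. Hence \<open>F\<close> is
  injective on the disk of radius \<open>\<rho>\<^sub>3\<close> and covers the disk of radius \<open>\<sigma>\<^sub>3\<close>, whose image under \<open>exp\<close>
  contains \<open>ball (cosh \<sigma>\<^sub>3) (sinh \<sigma>\<^sub>3)\<close>. Injectivity passes from \<open>F\<close> to \<open>f\<close> because \<open>Ln f\<close> is continuous,
  which forces \<open>F = Ln f\<close>.

  The bound \<open>\<bar>a\<^sub>k\<bar> \<le> Mstar\<^sub>k\<close> does not give \<open>\<bar>A\<^sub>k\<bar> \<le> M\<^sub>k\<close>, since \<open>a\<^sub>k\<close> may come close to \<open>0\<close>; it only places the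
  values of \<open>A\<^sub>k\<close> in the half-strip \<open>Re \<le> ln Mstar\<^sub>k\<close>, \<open>\<bar>Im\<bar> \<le> pi\<close>. The coefficient bound still
  holds there.
\<close>

section \<open>Coefficient bounds in a half-strip\<close>

text \<open>Cauchy's formula for the \<open>n\<close>-th derivative on the circle of radius
  \<open>r\<close>: there \<open>du = 2 * pi * \<i> * u dt\<close>, so the contour integral becomes
  a mean over \<open>{0..1}\<close>, the \<open>n\<close>-th Fourier coefficient of \<open>g\<close>
  on the circle.\<close>

lemma circle_mean_Taylor_coeff:
  assumes "g holomorphic_on ball 0 1" "0 < r" "r < 1"
  shows "((\<lambda>t. g (of_real r * exp (2 * of_real pi * \<i> * of_real t)) / exp (2 * of_real pi * \<i> * of_real t) ^ n)
           has_integral (deriv ^^ n) g 0 / fact n * of_real r ^ n) {0..1}"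
proof -
  have "g holomorphic_on cball 0 r"
    using assms by (intro holomorphic_on_subset[OF assms(1)]) auto
  then have "((\<lambda>u. g u / (u - 0) ^ Suc n) has_contour_integral (2 * pi * \<i>) / fact n * (deriv ^^ n) g 0) (circlepath 0 r)"
    using assms(2)
    by (intro Cauchy_has_contour_integral_higher_derivative_circlepath holomorphic_on_imp_continuous_on)
       (auto intro: holomorphic_on_subset)
  then have "((\<lambda>t. g (circlepath 0 r t) / circlepath 0 r t ^ Suc n
                * vector_derivative (circlepath 0 r) (at t within {0..1}))
              has_integral (2 * pi * \<i>) / fact n * (deriv ^^ n) g 0) {0..1}"
    by (simp add: has_contour_integral_def)
  \<comment> \<open>This factor cancels \<open>2 * pi * \<i>\<close> and turns \<open>u ^ n\<close>
    into the unimodular \<open>(u / r) ^ n\<close>.\<close>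
  then have "((\<lambda>t. of_real r ^ n / (2 * pi * \<i>) * (g (circlepath 0 r t) / circlepath 0 r t ^ Suc n
                * vector_derivative (circlepath 0 r) (at t within {0..1})))
              has_integral of_real r ^ n / (2 * pi * \<i>) * ((2 * pi * \<i>) / fact n * (deriv ^^ n) g 0)) {0..1}"
    by (rule has_integral_mult_right)
  also have "of_real r ^ n / (2 * pi * \<i>) * ((2 * pi * \<i>) / fact n * (deriv ^^ n) g 0)
      = (deriv ^^ n) g 0 / fact n * of_real r ^ n"
    using nonzero_mult_divide_mult_cancel_left[of "2 * pi * \<i>" "of_real r ^ n * (deriv ^^ n) g 0" "fact n"]
    by (simp only: times_divide_eq_left times_divide_eq_right divide_divide_eq_left mult_ac)
       (simp add: mult_ac)
  finally show ?thesis
  proof (rule has_integral_eq[rotated])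
    fix t :: real assume "t \<in> {0..1}"
    then show "of_real r ^ n / (2 * pi * \<i>) * (g (circlepath 0 r t) / circlepath 0 r t ^ Suc n
          * vector_derivative (circlepath 0 r) (at t within {0..1}))
        = g (of_real r * exp (2 * of_real pi * \<i> * of_real t)) / exp (2 * of_real pi * \<i> * of_real t) ^ n"
      using assms(2) by (subst vector_derivative_circlepath01)
        (auto simp: circlepath power_mult_distrib mult.commute[of _ "\<i>"] simp flip: mult.assoc)
  qed
qed

text \<open>Mean value property of \<open>g z * (z / r) ^ n\<close>, which vanishes at
  \<open>0\<close>; on the circle \<open>z / r\<close> is the exponential.\<close>

lemma circle_mean_positive_frequency:
  assumes "g holomorphic_on ball 0 1" "0 < r" "r < 1" "n \<ge> 1"
  shows "((\<lambda>t. g (of_real r * exp (2 * of_real pi * \<i> * of_real t)) * exp (2 * of_real pi * \<i> * of_real t) ^ n)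
           has_integral 0) {0..1}"
proof -
  have "(\<lambda>z. g z * (z / of_real r) ^ n) holomorphic_on ball 0 1"
    using assms by (intro holomorphic_intros) auto
  from circle_mean_Taylor_coeff[OF this assms(2,3), of 0] show ?thesis
    using assms by (simp add: zero_power)
qed

text \<open>On a circle \<open>cnj C\<close> has no \<open>n\<close>-th Fourier coefficient for
  \<open>n \<ge> 1\<close>, so \<open>C\<close> can be chosen freely to make
  \<open>A + cnj C\<close> easy to bound. The coefficient is then at most the circular mean of
  \<open>Re B\<close>, which is \<open>Re (B 0)\<close>.\<close>

lemma Taylor_coeff_le_majorant:
  assumes A: "A holomorphic_on ball 0 1" and C: "C holomorphic_on ball 0 1"
    and B: "B holomorphic_on ball 0 1"
    and le: "\<And>z. z \<in> ball 0 1 \<Longrightarrow> norm (A z + cnj (C z)) \<le> Re (B z)"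
    and n: "n \<ge> 1"
  shows "norm ((deriv ^^ n) A 0 / fact n) \<le> Re (B 0)"
proof -
  define c where "c = (deriv ^^ n) A 0 / fact n"
  have *: "norm c * r ^ n \<le> Re (B 0)" if r: "0 < r" "r < 1" for r
  proof -
    define e where "e t = exp (2 * of_real pi * \<i> * of_real t)" for t :: real
    have ne: "norm (e t) = 1" for t
      by (simp add: e_def)
    \<comment> \<open>Since conjugation inverts \<open>e t\<close>, the conjugate of the vanishing
      mean of \<open>C * e ^ n\<close> is the mean of \<open>cnj C / e ^ n\<close>.\<close>
    have ce: "cnj (e t) ^ n = 1 / e t ^ n" for t
    proof -
      have "cnj (e t) * e t = 1"
        using ne[of t] complex_norm_square[of "e t"] by (simp add: mult.commute)
      then have "cnj (e t) ^ n * e t ^ n = 1"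
        by (simp flip: power_mult_distrib)
      moreover have "e t \<noteq> 0"
        by (simp add: e_def)
      ultimately show ?thesis
        by (simp add: field_simps)
    qed
    have 1: "((\<lambda>t. A (of_real r * e t) / e t ^ n) has_integral c * of_real r ^ n) {0..1}"
      unfolding e_def c_def by (rule circle_mean_Taylor_coeff[OF A r])
    have "((\<lambda>t. C (of_real r * e t) * e t ^ n) has_integral 0) {0..1}"
      unfolding e_def by (rule circle_mean_positive_frequency[OF C r n])
    then have "(cnj \<circ> (\<lambda>t. C (of_real r * e t) * e t ^ n) has_integral cnj 0) {0..1}"
      by (subst has_integral_cnj)
    then have "((\<lambda>t. cnj (C (of_real r * e t)) / e t ^ n) has_integral 0) {0..1}"
      by (simp add: o_def ce)
    from has_integral_add[OF 1 this]
    have 2: "((\<lambda>t. (A (of_real r * e t) + cnj (C (of_real r * e t))) / e t ^ n)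
        has_integral c * of_real r ^ n) {0..1}"
      by (simp add: add_divide_distrib)
    have "((\<lambda>t. B (of_real r * e t)) has_integral B 0) {0..1}"
      using circle_mean_Taylor_coeff[OF B r, of 0] by (simp add: e_def)
    then have 3: "((\<lambda>t. Re (B (of_real r * e t))) has_integral Re (B 0)) {0..1}"
      by (rule has_integral_Re)
    have "norm (integral {0..1} (\<lambda>t. (A (of_real r * e t) + cnj (C (of_real r * e t))) / e t ^ n))
        \<le> integral {0..1} (\<lambda>t. Re (B (of_real r * e t)))"
    proof (rule Henstock_Kurzweil_Integration.integral_norm_bound_integral)
      fix t :: real
      show "norm ((A (of_real r * e t) + cnj (C (of_real r * e t))) / e t ^ n) \<le> Re (B (of_real r * e t))"
        using le[of "of_real r * e t"] r by (simp add: norm_divide norm_power norm_mult ne)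
    qed (use 2 3 in \<open>auto intro: has_integral_integrable\<close>)
    then show ?thesis
      using integral_unique[OF 2] integral_unique[OF 3] r
      by (simp add: norm_mult norm_power)
  qed
  \<comment> \<open>Each circle inside the unit disk costs a factor \<open>r ^ n\<close>, which
    disappears as \<open>r\<close> tends to \<open>1\<close>.\<close>
  have "((\<lambda>r. norm c * r ^ n) \<longlongrightarrow> norm c * 1 ^ n) (at_left 1)"
    by (intro tendsto_intros)
  moreover have "eventually (\<lambda>r. norm c * r ^ n \<le> Re (B 0)) (at_left (1::real))"
    unfolding eventually_at_left[OF zero_less_one] using * by (intro exI[of _ 0]) auto
  ultimately show ?thesis
    unfolding c_def[symmetric] by (auto dest: tendsto_upperbound)
qed

text \<open>
  Small \<open>L\<close>: Caratheodory's bound \<open>2 * L\<close> for the half-plane. Large \<open>L\<close>: the strip alone gives \<open>sqrt 2 * pi\<close>,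
  because \<open>\<bar>A\<bar>\<^sup>2 = Re (A\<^sup>2) + 2 * (Im A)\<^sup>2\<close> and \<open>Re (A\<^sup>2)\<close> has circular mean \<open>0\<close>.
\<close>

lemma Taylor_coeff_half_strip:
  assumes A: "A holomorphic_on ball 0 1" and "A 0 = 0"
    and Re: "\<And>z. z \<in> ball 0 1 \<Longrightarrow> Re (A z) \<le> L"
    and Im: "\<And>z. z \<in> ball 0 1 \<Longrightarrow> \<bar>Im (A z)\<bar> \<le> pi"
    and n: "n \<ge> 1" and "L > 0"
  shows "norm ((deriv ^^ n) A 0 / fact n) \<le> (L + pi) - 1 / (L + pi)"
proof (cases "L \<le> 8/3")
  \<comment> \<open>The threshold serves both cases, where \<open>1 / (L + pi) \<le> 1/3\<close>:
    below it \<open>2 * L \<le> L + pi - 1/3\<close> because \<open>pi > 3\<close>, above it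
    \<open>3/2 * pi \<le> L + pi - 1/3\<close> because \<open>pi < 4\<close>.\<close>
  case True
  have "norm ((deriv ^^ n) A 0 / fact n) \<le> Re (2 * of_real L - 2 * A 0)"
  \<comment> \<open>With this \<open>C\<close> the sum \<open>A + cnj C\<close> is the real number
    \<open>2 * Re A - 2 * L \<le> 0\<close>, so its norm equals \<open>Re B\<close>.\<close>
  proof (rule Taylor_coeff_le_majorant[where C = "\<lambda>z. A z - 2 * of_real L" and B = "\<lambda>z. 2 * of_real L - 2 * A z"])
    fix z :: complex assume z: "z \<in> ball 0 1"
    have "A z + cnj (A z - 2 * of_real L) = of_real (2 * Re (A z) - 2 * L)"
      by (simp add: complex_eq_iff)
    then show "norm (A z + cnj (A z - 2 * of_real L)) \<le> Re (2 * of_real L - 2 * A z)"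
      using Re[OF z] by (simp only: norm_of_real) simp
  qed (use n in \<open>auto intro!: holomorphic_intros A\<close>)
  then have "norm ((deriv ^^ n) A 0 / fact n) \<le> 2 * L"
    using \<open>A 0 = 0\<close> by simp
  moreover have "1 / (L + pi) \<le> 1 / 3"
    using \<open>L > 0\<close> pi_gt3 by (intro divide_left_mono) auto
  ultimately show ?thesis
    using True pi_gt3 by linarith
next
  case False
  define s where "s = sqrt 2 * pi"
  have s: "s > 0" "s\<^sup>2 = 2 * pi\<^sup>2"
    by (auto simp: s_def power_mult_distrib)
  have "norm ((deriv ^^ n) A 0 / fact n) \<le> Re ((A 0 ^ 2 + of_real (2 * s\<^sup>2)) / of_real (2 * s))"
  \<comment> \<open>\<open>B\<close> comes from \<open>2 * s * norm A \<le> (norm A)\<^sup>2 +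
    s\<^sup>2 \<le> Re (A\<^sup>2) + 2 * s\<^sup>2\<close>; its value at \<open>0\<close> is
    \<open>s\<close>.\<close>
  proof (rule Taylor_coeff_le_majorant[where C = "\<lambda>z. 0" and B = "\<lambda>z. (A z ^ 2 + of_real (2 * s\<^sup>2)) / of_real (2 * s)"])
    fix z :: complex assume z: "z \<in> ball 0 1"
    have "(Im (A z))\<^sup>2 \<le> pi\<^sup>2"
      using Im[OF z] by (intro abs_le_square_iff[THEN iffD1]) auto
    then have "(norm (A z))\<^sup>2 \<le> Re (A z ^ 2) + s\<^sup>2"
      unfolding s cmod_power2 by (simp add: power2_eq_square)
    moreover have "2 * s * norm (A z) \<le> (norm (A z))\<^sup>2 + s\<^sup>2"
      using zero_le_power2[of "norm (A z) - s"] by (simp add: power2_diff mult_ac)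
    ultimately have "2 * s * norm (A z) \<le> Re (A z ^ 2 + of_real (2 * s\<^sup>2))"
      by simp
    then show "norm (A z + cnj 0) \<le> Re ((A z ^ 2 + of_real (2 * s\<^sup>2)) / of_real (2 * s))"
      unfolding Re_divide_of_real using s(1) by (simp add: pos_le_divide_eq mult.commute)
  qed (use n s in \<open>auto intro!: holomorphic_intros A\<close>)
  also have "\<dots> = s"
    unfolding Re_divide_of_real using \<open>A 0 = 0\<close> s(1) by (simp add: power2_eq_square)
  also have "s \<le> 3/2 * pi"
    unfolding s_def by (intro mult_right_mono real_le_lsqrt) (auto simp: power2_eq_square)
  also have "1 / (L + pi) \<le> 1 / 3"
    using \<open>L > 0\<close> pi_gt3 by (intro divide_left_mono) auto
  then have "3/2 * pi \<le> (L + pi) - 1 / (L + pi)"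
    using False pi_less_4 by linarith
  finally show ?thesis .
qed

section \<open>Exponential image of a disk\<close>

lemma sinh_le_mult_cosh:
  assumes "0 \<le> (s::real)"
  shows "sinh s \<le> s * cosh s"
proof -
  have "0 * cosh 0 - sinh 0 \<le> s * cosh s - sinh s"
    by (rule DERIV_nonneg_imp_nondecreasing[OF assms])
       (auto intro!: derivative_eq_intros exI simp: mult_nonneg_nonneg)
  then show ?thesis
    by simp
qed

lemma mult_cos_le_sin:
  assumes "0 \<le> t" "t \<le> pi"
  shows "t * cos t \<le> sin t"
proof -
  have "sin 0 - 0 * cos 0 \<le> sin t - t * cos t"
    by (rule DERIV_nonneg_imp_nondecreasing[OF assms(1)])
       (use assms in \<open>auto intro!: derivative_eq_intros exI mult_nonneg_nonneg sin_ge_zero\<close>)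
  then show ?thesis
    by simp
qed

text \<open>The left side decreases in \<open>y\<close>, starting from \<open>cosh x\<close> at
  \<open>y = 0\<close>: the sign of its derivative follows from \<open>t * cos t \<le> sin t\<close>
  and \<open>sinh s \<le> s * cosh s\<close>.\<close>

lemma cos_cosh_sqrt_le_cosh:
  fixes x y :: real
  assumes y: "0 \<le> y" "y \<le> pi / 2"
  shows "cos y * cosh (sqrt (x\<^sup>2 + y\<^sup>2)) \<le> cosh x"
proof -
  have "cos y * cosh (sqrt (x\<^sup>2 + y\<^sup>2)) \<le> cos 0 * cosh (sqrt (x\<^sup>2 + 0\<^sup>2))"
  \<comment> \<open>Only interior derivatives are used: for \<open>x = 0\<close> the square root is
    not differentiable at \<open>t = 0\<close>.\<close>
  proof (rule DERIV_nonpos_imp_decreasing_open[OF y(1)])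
    fix t assume t: "0 < t" "t < y"
    define s where "s = sqrt (x\<^sup>2 + t\<^sup>2)"
    have "x\<^sup>2 + t\<^sup>2 > 0"
      using t by (intro add_nonneg_pos) auto
    then have s: "s > 0"
      by (simp add: s_def)
    have "((\<lambda>t. cos t * cosh (sqrt (x\<^sup>2 + t\<^sup>2))) has_real_derivative
        (t * cos t * sinh s / s - sin t * cosh s)) (at t)"
      using \<open>x\<^sup>2 + t\<^sup>2 > 0\<close> unfolding s_def
      by (auto intro!: derivative_eq_intros simp: field_simps)
    moreover have "t * cos t * sinh s / s \<le> sin t * cosh s"
    proof -
      have "t * cos t * sinh s \<le> sin t * (s * cosh s)"
        using t y s by (intro mult_mono mult_cos_le_sin sinh_le_mult_cosh sin_ge_zero) auto
      then show ?thesis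
        using s by (simp add: field_simps)
    qed
    ultimately show "\<exists>D. ((\<lambda>t. cos t * cosh (sqrt (x\<^sup>2 + t\<^sup>2))) has_real_derivative D) (at t) \<and> D \<le> 0"
      by (intro exI conjI) auto
  qed (intro continuous_intros)
  then show ?thesis
    by simp
qed

text \<open>Expanding \<open>(norm (exp u - cosh \<sigma>))\<^sup>2\<close> and using
  \<open>cosh\<^sup>2 = sinh\<^sup>2 + 1\<close> shows that \<open>exp u\<close> lies outside the
  disk exactly when \<open>cos (Im u) * cosh \<sigma> \<le> cosh (Re u)\<close>. This holds for a
  principal logarithm \<open>u\<close> of norm at least \<open>\<sigma>\<close>.\<close>

lemma ball_cosh_sinh_subset_exp_ball:
  assumes "0 \<le> \<sigma>"
  shows "ball (complex_of_real (cosh \<sigma>)) (sinh \<sigma>) \<subseteq> exp ` ball 0 \<sigma>"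
proof
  fix w assume w: "w \<in> ball (complex_of_real (cosh \<sigma>)) (sinh \<sigma>)"
  have "w \<noteq> 0"
  proof
    assume "w = 0"
    then show False
      using w sinh_le_cosh_real[of \<sigma>] by simp
  qed
  define u where "u = Ln w"
  have u: "exp u = w" "\<bar>Im u\<bar> \<le> pi"
    using \<open>w \<noteq> 0\<close> mpi_less_Im_Ln[of w] Im_Ln_le_pi[of w] by (auto simp: u_def)
  have "norm u < \<sigma>"
  proof (rule ccontr)
    assume "\<not> norm u < \<sigma>"
    have "cos (Im u) * cosh \<sigma> \<le> cosh (Re u)"
    proof (cases "\<bar>Im u\<bar> \<le> pi / 2")
      case True
      then have "0 \<le> cos (Im u)"
        by (intro cos_ge_zero) auto
      then have "cos (Im u) * cosh \<sigma> \<le> cos \<bar>Im u\<bar> * cosh (sqrt ((Re u)\<^sup>2 + \<bar>Im u\<bar>\<^sup>2))"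
        using \<open>\<not> norm u < \<sigma>\<close> assms
        by (auto simp: cosh_real_nonneg_le_iff cmod_def intro!: mult_left_mono)
      also have "\<dots> \<le> cosh (Re u)"
        using True by (intro cos_cosh_sqrt_le_cosh) auto
      finally show ?thesis .
    next
      case False
      then have "cos \<bar>Im u\<bar> \<le> cos (pi / 2)"
        using u(2) by (intro cos_monotone_0_pi_le) auto
      then have "cos (Im u) * cosh \<sigma> \<le> 0"
        by (simp add: mult_nonpos_nonneg)
      then show ?thesis
        using cosh_real_nonneg[of "Re u"] by linarith
    qed
    then have "2 * exp (Re u) * (cos (Im u) * cosh \<sigma>) \<le> 2 * exp (Re u) * cosh (Re u)"
      by (intro mult_left_mono) auto
    also have "\<dots> = exp (Re u) ^ 2 + 1"
      by (simp add: cosh_field_def field_simps power2_eq_square exp_minus)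
    finally have le: "2 * exp (Re u) * (cos (Im u) * cosh \<sigma>) \<le> exp (Re u) ^ 2 + 1" .
    have "(norm (w - complex_of_real (cosh \<sigma>)))\<^sup>2
        = (exp (Re u) * cos (Im u) - cosh \<sigma>)\<^sup>2 + (exp (Re u) * sin (Im u))\<^sup>2"
      unfolding u(1)[symmetric] cmod_power2 by (simp add: Re_exp Im_exp)
    also have "\<dots> = exp (Re u) ^ 2 * ((cos (Im u))\<^sup>2 + (sin (Im u))\<^sup>2)
        - 2 * exp (Re u) * (cos (Im u) * cosh \<sigma>) + (cosh \<sigma>)\<^sup>2"
      by algebra
    also have "\<dots> \<ge> (sinh \<sigma>)\<^sup>2"
      using le cosh_square_eq[of \<sigma>] by simp
    finally have "sinh \<sigma> \<le> norm (w - complex_of_real (cosh \<sigma>))"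
      by (rule power2_le_imp_le) auto
    then show False
      using w by (simp add: dist_norm norm_minus_commute)
  qed
  then show "w \<in> exp ` ball 0 \<sigma>"
    using u(1) by (intro image_eqI[of _ _ u]) auto
qed

section \<open>Growth and distortion\<close>

lemma norm_power_Suc_diff_le:
  fixes z w :: complex
  assumes z: "norm z \<le> R" and w: "norm w \<le> R"
  shows "norm (z ^ Suc m - w ^ Suc m) \<le> (real m + 1) * R ^ m * norm (z - w)"
proof (induction m)
  case (Suc m)
  have R: "0 \<le> R"
    using z norm_ge_zero order_trans by blast
  have "z ^ Suc (Suc m) - w ^ Suc (Suc m) = z * (z ^ Suc m - w ^ Suc m) + (z - w) * w ^ Suc m"
    by (simp add: algebra_simps)
  then have "norm (z ^ Suc (Suc m) - w ^ Suc (Suc m))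
      \<le> norm z * norm (z ^ Suc m - w ^ Suc m) + norm (z - w) * norm w ^ Suc m"
    by (metis norm_mult norm_power norm_triangle_ineq)
  also have "\<dots> \<le> R * ((real m + 1) * R ^ m * norm (z - w)) + norm (z - w) * R ^ Suc m"
    using z w R Suc by (intro add_mono mult_mono power_mono) auto
  also have "\<dots> = (real (Suc m) + 1) * R ^ Suc m * norm (z - w)"
    by (simp add: algebra_simps)
  finally show ?case .
qed simp

text \<open>Conjugation is an isometry, so a conjugated factor counts like any other: the Lipschitz
  constant is that of a power of degree \<open>k + m + 1\<close>.\<close>

lemma norm_cnj_power_mult_power_diff_le:
  fixes z w :: complex
  assumes z: "norm z \<le> R" and w: "norm w \<le> R"
  shows "norm (cnj z ^ k * z ^ Suc m - cnj w ^ k * w ^ Suc m)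
           \<le> (real k + real m + 1) * R ^ (k + m) * norm (z - w)"
proof (induction k)
  case 0
  then show ?case
    using norm_power_Suc_diff_le[OF assms] by simp
next
  case (Suc k)
  have R: "0 \<le> R"
    using z norm_ge_zero order_trans by blast
  define X where "X z = cnj z ^ k * z ^ Suc m" for z
  have X: "norm (X w) \<le> R ^ (k + Suc m)"
    unfolding X_def norm_mult norm_power complex_mod_cnj power_add
    using w R by (intro mult_mono power_mono) auto
  have "cnj z ^ Suc k * z ^ Suc m - cnj w ^ Suc k * w ^ Suc m = cnj z * (X z - X w) + cnj (z - w) * X w"
    by (simp add: X_def algebra_simps)
  then have "norm (cnj z ^ Suc k * z ^ Suc m - cnj w ^ Suc k * w ^ Suc m)
      \<le> norm z * norm (X z - X w) + norm (z - w) * norm (X w)"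
    by (metis complex_mod_cnj norm_mult norm_triangle_ineq)
  also have "\<dots> \<le> R * ((real k + real m + 1) * R ^ (k + m) * norm (z - w)) + norm (z - w) * R ^ (k + Suc m)"
    using z w R Suc X by (intro add_mono mult_mono) (auto simp: X_def)
  also have "\<dots> = (real (Suc k) + real m + 1) * R ^ (Suc k + m) * norm (z - w)"
    by (simp add: algebra_simps)
  finally show ?case .
qed

lemma norm_sums_le:
  fixes f :: "nat \<Rightarrow> complex"
  assumes "f sums s" "g sums t" "\<And>n. norm (f n) \<le> g n"
  shows "norm s \<le> t"
  using norm_suminf_le[of f g] assms by (auto simp: sums_iff)

text \<open>Sums the Lipschitz constants of \<open>cnj z ^ k * z ^ (n+2)\<close>, by splitting
  \<open>k + n + 2\<close> as \<open>(n + 1) + (k + 1)\<close> into a differentiated geometric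
  series and a geometric one. The value is the factor in \<open>rho_fun\<close>.\<close>

lemma distortion_series_sums:
  assumes "0 \<le> R" "R < (1::real)"
  shows "(\<lambda>n. (real k + real n + 2) * R ^ (k + Suc n))
           sums (R ^ (k+1) * (2 - R + real k * (1 - R)) / (1 - R)\<^sup>2)"
proof -
  have "(\<lambda>n. R ^ (k+1) * (real (Suc n) * R ^ n + (real k + 1) * R ^ n))
      sums (R ^ (k+1) * (1 / (1 - R)\<^sup>2 + (real k + 1) * (1 / (1 - R))))"
    using assms by (intro sums_mult sums_add geometric_deriv_sums geometric_sums) auto
  also have "(\<lambda>n. R ^ (k+1) * (real (Suc n) * R ^ n + (real k + 1) * R ^ n))
      = (\<lambda>n. (real k + real n + 2) * R ^ (k + Suc n))"
    by (simp add: fun_eq_iff power_add algebra_simps)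
  also have "1 / (1 - R)\<^sup>2 + (real k + 1) * (1 / (1 - R)) = (2 - R + real k * (1 - R)) / (1 - R)\<^sup>2"
    using assms by (simp add: power2_eq_square divide_simps) (simp add: algebra_simps)
  finally show ?thesis
    by simp
qed

lemma Taylor_remainder_sums:
  assumes "h holomorphic_on ball 0 1" "h 0 = 0" "deriv h 0 = 1" "norm z < 1"
  shows "(\<lambda>n. (deriv ^^ (n+2)) h 0 / fact (n+2) * z ^ (n+2)) sums (h z - z)"
proof -
  have "(\<lambda>n. (deriv ^^ n) h 0 / fact n * (z - 0) ^ n) sums h z"
    using assms by (intro holomorphic_power_series) auto
  then show ?thesis
    using assms sums_split_initial_segment[of _ "h z" 2] by (force simp: numeral_2_eq_2)
qed

text \<open>The Taylor remainder starts at order \<open>2\<close> and \<open>cnj z ^ k\<close>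
  raises each exponent by \<open>k\<close>; the geometric series gives the summand of
  \<open>sigma_fun\<close>.\<close>

lemma growth_estimate:
  assumes h: "h holomorphic_on ball 0 1" "h 0 = 0" "deriv h 0 = 1"
    and c: "\<And>n. n \<ge> 2 \<Longrightarrow> norm ((deriv ^^ n) h 0 / fact n) \<le> c"
    and z: "norm z < 1"
  shows "norm (cnj z ^ k * h z - cnj z ^ k * z) \<le> c * (norm z ^ (k+2) / (1 - norm z))"
proof -
  have "(\<lambda>n. cnj z ^ k * ((deriv ^^ (n+2)) h 0 / fact (n+2) * z ^ (n+2))) sums (cnj z ^ k * (h z - z))"
    by (intro sums_mult Taylor_remainder_sums h z)
  moreover have "(\<lambda>n. c * norm z ^ (k+2) * norm z ^ n) sums (c * norm z ^ (k+2) * (1 / (1 - norm z)))"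
    using z by (intro sums_mult geometric_sums) auto
  moreover have "norm (cnj z ^ k * ((deriv ^^ (n+2)) h 0 / fact (n+2) * z ^ (n+2)))
      \<le> c * norm z ^ (k+2) * norm z ^ n" for n
  proof -
    have "norm (cnj z ^ k * ((deriv ^^ (n+2)) h 0 / fact (n+2) * z ^ (n+2)))
        = norm ((deriv ^^ (n+2)) h 0 / fact (n+2)) * (norm z ^ (k+2) * norm z ^ n)"
      unfolding norm_mult norm_power complex_mod_cnj by (simp add: power_add mult_ac)
    also have "\<dots> \<le> c * (norm z ^ (k+2) * norm z ^ n)"
      by (intro mult_right_mono c) auto
    finally show ?thesis
      by (simp add: mult_ac)
  qed
  ultimately have "norm (cnj z ^ k * (h z - z)) \<le> c * norm z ^ (k+2) * (1 / (1 - norm z))"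
    by (rule norm_sums_le)
  then show ?thesis
    by (simp add: right_diff_distrib)
qed

lemma distortion_estimate:
  assumes h: "h holomorphic_on ball 0 1" "h 0 = 0" "deriv h 0 = 1"
    and c: "\<And>n. n \<ge> 2 \<Longrightarrow> norm ((deriv ^^ n) h 0 / fact n) \<le> c"
    and z: "norm z \<le> R" and w: "norm w \<le> R" and R: "R < 1"
  shows "norm ((cnj z ^ k * h z - cnj w ^ k * h w) - (cnj z ^ k * z - cnj w ^ k * w))
           \<le> c * (R ^ (k+1) * (2 - R + real k * (1 - R)) / (1 - R)\<^sup>2) * norm (z - w)"
proof -
  have R0: "0 \<le> R"
    using z norm_ge_zero order_trans by blast
  define b where "b n = (deriv ^^ (n+2)) h 0 / fact (n+2)" for n
  have "(\<lambda>n. cnj z ^ k * (b n * z ^ (n+2)) - cnj w ^ k * (b n * w ^ (n+2)))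
      sums (cnj z ^ k * (h z - z) - cnj w ^ k * (h w - w))"
    unfolding b_def using z w R by (intro sums_diff sums_mult Taylor_remainder_sums h) auto
  moreover have "(\<lambda>n. c * ((real k + real n + 2) * R ^ (k + Suc n)) * norm (z - w))
      sums (c * (R ^ (k+1) * (2 - R + real k * (1 - R)) / (1 - R)\<^sup>2) * norm (z - w))"
    using R R0 by (intro sums_mult sums_mult2 distortion_series_sums) auto
  moreover have "norm (cnj z ^ k * (b n * z ^ (n+2)) - cnj w ^ k * (b n * w ^ (n+2)))
      \<le> c * ((real k + real n + 2) * R ^ (k + Suc n)) * norm (z - w)" for n
  proof -
    have "norm (cnj z ^ k * (b n * z ^ (n+2)) - cnj w ^ k * (b n * w ^ (n+2)))
        = norm (b n) * norm (cnj z ^ k * z ^ Suc (Suc n) - cnj w ^ k * w ^ Suc (Suc n))"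
      unfolding norm_mult[symmetric] by (simp add: algebra_simps)
    also have "\<dots> \<le> c * ((real k + real (Suc n) + 1) * R ^ (k + Suc n) * norm (z - w))"
      unfolding b_def using c[of "n+2"] order_trans[OF norm_ge_zero c[of "n+2"]]
      by (intro mult_mono norm_cnj_power_mult_power_diff_le z w) auto
    finally show ?thesis
      by (simp add: algebra_simps)
  qed
  ultimately have "norm (cnj z ^ k * (h z - z) - cnj w ^ k * (h w - w))
      \<le> c * (R ^ (k+1) * (2 - R + real k * (1 - R)) / (1 - R)\<^sup>2) * norm (z - w)"
    by (rule norm_sums_le)
  then show ?thesis
    by (simp add: algebra_simps)
qed

lemma sum_power_Suc_from_1:
  assumes "r \<noteq> (1::real)"
  shows "(\<Sum>k=1..q. r ^ (k+1)) = r\<^sup>2 * ((1 - r ^ q) / (1 - r))"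
proof (induction q)
  case (Suc q)
  have "(\<Sum>k=1..Suc q. r ^ (k+1)) = r\<^sup>2 * ((1 - r ^ q) / (1 - r)) + r ^ (q + 2)"
    unfolding Suc.IH[symmetric] by simp
  also have "\<dots> = r\<^sup>2 * ((1 - r ^ Suc q) / (1 - r))"
    using assms by (simp add: power2_eq_square divide_simps) (simp add: algebra_simps)
  finally show ?case .
qed simp

text \<open>Splits \<open>F\<close> into \<open>z\<close>, the terms \<open>cnj z ^ k * z\<close>
  with \<open>k \<ge> 1\<close> (collected in \<open>G\<close>) and the Taylor remainders of the
  \<open>A k\<close>. Subtracting the bounds for the last two from \<open>norm (z - w)\<close> or
  \<open>norm z\<close> produces \<open>rho_fun\<close> and \<open>sigma_fun\<close>.\<close>

lemma
  fixes A :: "nat \<Rightarrow> complex \<Rightarrow> complex"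
  assumes hol: "\<And>k. k \<le> p - 1 \<Longrightarrow> A k holomorphic_on ball 0 1"
    and A0: "\<And>k. k \<le> p - 1 \<Longrightarrow> A k 0 = 0" and A1: "\<And>k. k \<le> p - 1 \<Longrightarrow> deriv (A k) 0 = 1"
    and coeff: "\<And>k n. k \<le> p - 1 \<Longrightarrow> n \<ge> 2 \<Longrightarrow> norm ((deriv ^^ n) (A k) 0 / fact n) \<le> M k - 1 / M k"
  defines "F \<equiv> (\<lambda>z. \<Sum>k=0..p-1. cnj z ^ k * A k z)"
  shows poly_analytic_distortion:
      "norm z \<le> R \<Longrightarrow> norm w \<le> R \<Longrightarrow> R < 1 \<Longrightarrow> rho_fun p M R * norm (z - w) \<le> norm (F z - F w)"
    and poly_analytic_growth: "norm z < 1 \<Longrightarrow> sigma_fun p M (norm z) \<le> norm (F z)"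
proof -
  define G :: "complex \<Rightarrow> complex" where "G z = (\<Sum>k=1..p-1. cnj z ^ k * z)" for z
  have G: "(\<Sum>k=0..p-1. cnj z ^ k * z) = z + G z" for z :: complex
    unfolding G_def by (simp add: sum.atLeast_Suc_atMost)
  {
    assume R: "norm z \<le> R" "norm w \<le> R" "R < 1"
    have "norm ((F z - F w) - ((z + G z) - (w + G w)))
        = norm (\<Sum>k=0..p-1. (cnj z ^ k * A k z - cnj w ^ k * A k w) - (cnj z ^ k * z - cnj w ^ k * w))"
      unfolding F_def G[symmetric] by (simp add: sum_subtractf)
    also have "\<dots> \<le> (\<Sum>k=0..p-1. (M k - 1 / M k) *
        (R ^ (k+1) * (2 - R + real k * (1 - R)) / (1 - R)\<^sup>2) * norm (z - w))"
      by (intro order_trans[OF norm_sum] sum_mono distortion_estimate hol A0 A1 coeff R) auto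
    also have "\<dots> = (\<Sum>k=0..p-1. (M k - 1 / M k) *
        (R ^ (k+1) * (2 - R + real k * (1 - R)) / (1 - R)\<^sup>2)) * norm (z - w)"
      by (simp only: sum_distrib_right)
    finally have 1: "norm ((F z - F w) - ((z + G z) - (w + G w))) \<le> \<dots>" .
    have "norm (G z - G w) \<le> (\<Sum>k=1..p-1. (real k + real 0 + 1) * R ^ (k + 0) * norm (z - w))"
      unfolding G_def sum_subtractf[symmetric]
      using norm_cnj_power_mult_power_diff_le[OF R(1,2), of _ 0]
      by (intro order_trans[OF norm_sum] sum_mono) simp
    also have "\<dots> = (\<Sum>k=1..p-1. (real k + 1) * R ^ k) * norm (z - w)"
      by (simp add: sum_distrib_right)
    finally have 2: "norm (G z - G w) \<le> \<dots>" .
    have "norm (z - w) \<le> norm (F z - F w) + norm ((F z - F w) - ((z + G z) - (w + G w))) + norm (G z - G w)"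
      by norm
    with 1 2 show "rho_fun p M R * norm (z - w) \<le> norm (F z - F w)"
      unfolding rho_fun_def left_diff_distrib by linarith
  }
  {
    assume z: "norm z < 1"
    have "norm (F z - (z + G z)) = norm (\<Sum>k=0..p-1. cnj z ^ k * A k z - cnj z ^ k * z)"
      unfolding F_def G[symmetric] by (simp add: sum_subtractf)
    also have "\<dots> \<le> (\<Sum>k=0..p-1. (M k - 1 / M k) * (norm z ^ (k+2) / (1 - norm z)))"
      by (intro order_trans[OF norm_sum] sum_mono growth_estimate hol A0 A1 coeff z) auto
    finally have 1: "norm (F z - (z + G z)) \<le> \<dots>" .
    have "norm (G z) \<le> (\<Sum>k=1..p-1. norm z ^ (k+1))"
      unfolding G_def by (rule order_trans[OF norm_sum]) (simp add: norm_mult norm_power mult.commute)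
    also have "\<dots> = (norm z)\<^sup>2 * ((1 - norm z ^ (p-1)) / (1 - norm z))"
      using z by (intro sum_power_Suc_from_1) simp
    finally have 2: "norm (G z) \<le> \<dots>" .
    have "norm z \<le> norm (F z) + norm (F z - (z + G z)) + norm (G z)"
      by norm
    with 1 2 show "sigma_fun p M (norm z) \<le> norm (F z)"
      unfolding sigma_fun_def by linarith
  }
qed

section \<open>Logarithms and coverings\<close>

text \<open>The Cauchy-Riemann equation in the form \<open>T \<i> = \<i> * T 1\<close> makes the
  real-linear derivative \<open>T\<close> complex-linear.\<close>

lemma log_analytic_on_imp_holomorphic_Ln:
  assumes "log_analytic_on a D"
  shows "(\<lambda>z. Ln (a z)) holomorphic_on D"
proof -
  define G where "G = (\<lambda>z. Ln (a z))"
  have "open D" and dG: "\<And>z. z \<in> D \<Longrightarrow> G differentiable (at z)"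
    and dbar: "\<And>z. z \<in> D \<Longrightarrow> wirtinger_dbar G z = 0"
    using assms
    by (auto simp: log_analytic_on_def log_poly_analytic_on_def poly_analytic_on_def is_domain_def G_def)
  have "G field_differentiable (at z)" if z: "z \<in> D" for z
  proof -
    define T where "T = frechet_derivative G (at z)"
    have T: "(G has_derivative T) (at z)"
      using dG[OF z] by (simp add: T_def frechet_derivative_works)
    interpret linear T
      using T by (rule has_derivative_linear)
    have "\<i> * (T 1 + \<i> * T \<i>) = 0"
      using dbar[OF z] by (simp add: wirtinger_dbar_def T_def)
    then have Ti: "T \<i> = \<i> * T 1"
      by (simp add: algebra_simps)
    have "h * T 1 = T h" for h
    proof -
      have "h = Re h *\<^sub>R 1 + Im h *\<^sub>R \<i>"
        by (simp add: complex_eq_iff)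
      then have "T h = Re h *\<^sub>R T 1 + Im h *\<^sub>R (\<i> * T 1)"
        by (metis add scale Ti)
      also have "\<dots> = (Re h *\<^sub>R 1 + Im h *\<^sub>R \<i>) * T 1"
        by (simp add: algebra_simps)
      also have "Re h *\<^sub>R 1 + Im h *\<^sub>R \<i> = h"
        by (simp add: complex_eq_iff)
      finally show ?thesis ..
    qed
    with T show ?thesis
      by (auto simp: field_differentiable_def intro: has_derivative_imp_has_field_derivative)
  qed
  then show ?thesis
    using \<open>open D\<close> unfolding G_def[symmetric] by (simp add: holomorphic_on_open field_differentiable_def)
qed

text \<open>\<open>g - h\<close> takes values in the integer multiples of
  \<open>2 * pi * \<i>\<close>, which are \<open>2 * pi\<close> apart, so by continuity it is
  constant.\<close>

lemma exp_eq_imp_eq_on_connected: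
  fixes g h :: "complex \<Rightarrow> complex"
  assumes "connected S" "continuous_on S g" "continuous_on S h"
    and eq: "\<And>x. x \<in> S \<Longrightarrow> exp (g x) = exp (h x)"
    and "a \<in> S" "g a = h a" "x \<in> S"
  shows "g x = h x"
proof -
  have "(\<lambda>x. g x - h x) constant_on S"
  proof (rule continuous_discrete_range_constant[OF \<open>connected S\<close>])
    show "continuous_on S (\<lambda>x. g x - h x)"
      by (intro continuous_intros assms)
    fix x assume x: "x \<in> S"
    have "2 * pi \<le> norm (g y - h y - (g x - h x))" if y: "y \<in> S" "g y - h y \<noteq> g x - h x" for y
    proof (rule ccontr)
      assume "\<not> ?thesis"
      then have "\<bar>Im (g y - h y) - Im (g x - h x)\<bar> < 2 * pi"
        using abs_Im_le_cmod[of "g y - h y - (g x - h x)"] by simp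
      moreover have "exp (g y - h y) = exp (g x - h x)"
        using eq[OF x] eq[OF y(1)] by (simp add: exp_diff)
      ultimately show False
        using y(2) exp_complex_eqI by blast
    qed
    then show "\<exists>e>0. \<forall>y. y \<in> S \<and> g y - h y \<noteq> g x - h x \<longrightarrow> e \<le> norm (g y - h y - (g x - h x))"
      by (intro exI[of _ "2 * pi"]) auto
  qed
  then show ?thesis
    using assms(5-7) unfolding constant_on_def by (metis eq_iff_diff_eq_0)
qed

text \<open>The covered part of \<open>ball 0 \<sigma>\<close> is open by invariance of domain. It
  is also closed: the bounding circle is mapped outside \<open>ball 0 \<sigma>\<close>, so the
  compact disk covers the same part. Connectedness concludes.\<close>

lemma ball_subset_image_ball:
  fixes F :: "complex \<Rightarrow> complex"
  assumes cont: "continuous_on (cball 0 r) F" and inj: "inj_on F (ball 0 r)"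
    and F0: "F 0 = 0" and bd: "\<And>z. norm z = r \<Longrightarrow> \<sigma> \<le> norm (F z)" and "0 < r" "0 < \<sigma>"
  shows "ball 0 \<sigma> \<subseteq> F ` ball 0 r"
proof -
  define T where "T = ball 0 \<sigma> \<inter> F ` ball 0 r"
  have "open (F ` ball 0 r)"
    using cont inj by (intro invariance_of_domain) (auto intro: continuous_on_subset)
  then have "openin (top_of_set (ball 0 \<sigma>)) T"
    unfolding T_def by (rule openin_open_Int)
  moreover have "T = ball 0 \<sigma> \<inter> F ` cball 0 r"
  proof -
    have "norm z < r" if "norm (F z) < \<sigma>" "norm z \<le> r" for z
      using that bd[of z] by force
    then show ?thesis
      unfolding T_def by fastforce
  qed
  then have "closedin (top_of_set (ball 0 \<sigma>)) T"
    using cont by (auto intro!: closedin_closed_Int compact_imp_closed compact_continuous_image)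
  moreover have "0 \<in> T"
    using F0 \<open>0 < r\<close> \<open>0 < \<sigma>\<close> by (force simp: T_def)
  moreover have "connected (ball (0::complex) \<sigma>)"
    by simp
  ultimately have "T = ball 0 \<sigma>"
    unfolding connected_clopen by blast
  then show ?thesis
    unfolding T_def by blast
qed

text \<open>The region is the image of the ball under the continuous inverse of \<open>f\<close>,
  open by invariance of domain.\<close>

lemma contains_schlicht_disk_of_subset_image:
  assumes "continuous_on S f" "open S" "inj_on f S" "ball w r \<subseteq> f ` S" "r > 0"
  shows "contains_schlicht_disk f S w r"
proof -
  obtain g where g: "homeomorphism S (f ` S) f g"
    using invariance_of_domain_homeomorphism[of S f] assms by auto
  have fg: "f (g y) = y" "g y \<in> S" if "y \<in> ball w r" for y
    using g assms(4) that by (auto simp: homeomorphism_def)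
  have cont: "continuous_on (ball w r) g"
    using g assms(4) by (auto simp: homeomorphism_def intro: continuous_on_subset)
  have "inj_on g (ball w r)"
    by (metis fg(1) inj_onI)
  then have "open (g ` ball w r)"
    using cont by (intro invariance_of_domain) auto
  moreover have "connected (g ` ball w r)"
    using cont by (intro connected_continuous_image) auto
  moreover have "f ` g ` ball w r = ball w r"
    using fg(1) by (simp add: image_image)
  moreover have "inj_on f (g ` ball w r)"
    using assms(3) fg(2) by (auto intro: inj_on_subset)
  ultimately show ?thesis
    unfolding contains_schlicht_disk_def is_domain_def
    using fg(2) \<open>r > 0\<close> by (intro conjI exI[of _ "g ` ball w r"]) auto
qed

section \<open>The radius functions\<close>

text \<open>In this form each ingredient is visibly monotone in \<open>r\<close>.\<close>

lemma distortion_factor_eq: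
  assumes "r < (1::real)"
  shows "r ^ (k+1) * (2 - r + real k * (1 - r)) / (1 - r)\<^sup>2
           = r ^ (k+1) * (1 / (1 - r)\<^sup>2 + (real k + 1) / (1 - r))"
  using assms by (simp add: power2_eq_square divide_simps) (simp add: algebra_simps)

lemma rho_fun_strict_antimono:
  assumes c: "\<And>k. k \<le> p - 1 \<Longrightarrow> 0 < M k - 1 / M k" and r: "0 \<le> r" "r < s" "s < 1"
  shows "rho_fun p M s < rho_fun p M r"
proof -
  have "(M k - 1 / M k) * (r ^ (k+1) * (2 - r + real k * (1 - r)) / (1 - r)\<^sup>2)
      < (M k - 1 / M k) * (s ^ (k+1) * (2 - s + real k * (1 - s)) / (1 - s)\<^sup>2)"
    if k: "k \<le> p - 1" for k
  proof -
    have "0 < 1 / (1 - r)\<^sup>2 + (real k + 1) / (1 - r)"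
      using r by (intro add_pos_nonneg divide_pos_pos divide_nonneg_nonneg) auto
    then have "r ^ (k+1) * (1 / (1 - r)\<^sup>2 + (real k + 1) / (1 - r))
        < s ^ (k+1) * (1 / (1 - s)\<^sup>2 + (real k + 1) / (1 - s))"
      using r by (intro mult_less_le_imp_less add_mono divide_left_mono power_strict_mono power_mono
          mult_pos_pos) auto
    then show ?thesis
      using c[OF k] r by (subst (1 2) distortion_factor_eq) (auto intro!: mult_strict_left_mono)
  qed
  then have "(\<Sum>k=0..p-1. (M k - 1 / M k) * (r ^ (k+1) * (2 - r + real k * (1 - r)) / (1 - r)\<^sup>2))
      < (\<Sum>k=0..p-1. (M k - 1 / M k) * (s ^ (k+1) * (2 - s + real k * (1 - s)) / (1 - s)\<^sup>2))"
    by (intro sum_strict_mono) auto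
  \<comment> \<open>For \<open>p = 1\<close> this sum is empty; strictness comes from the other sum,
    which always contains \<open>k = 0\<close>.\<close>
  moreover have "(\<Sum>k=1..p-1. (real k + 1) * r ^ k) \<le> (\<Sum>k=1..p-1. (real k + 1) * s ^ k)"
    using r by (intro sum_mono mult_left_mono power_mono) auto
  ultimately show ?thesis
    unfolding rho_fun_def by linarith
qed

lemma rho_fun_0: "rho_fun p M 0 = 1"
  by (auto simp: rho_fun_def zero_power intro!: sum.neutral)

text \<open>At \<open>1/2\<close> the summand for \<open>k = 0\<close> is
  \<open>3 * (M 0 - 1 / M 0)\<close>, which alone outweighs the leading \<open>1\<close>.\<close>

lemma rho_fun_half_neg:
  assumes c: "\<And>k. k \<le> p - 1 \<Longrightarrow> 1 < M k - 1 / M k"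
  shows "rho_fun p M (1/2) < 0"
proof -
  define T where "T k = (M k - 1 / M k) *
    ((1/2) ^ (k+1) * (2 - 1/2 + real k * (1 - 1/2)) / (1 - 1/2)\<^sup>2)" for k
  have T: "0 \<le> T k" if "k \<le> p - 1" for k
    unfolding T_def using c[OF that]
    by (intro mult_nonneg_nonneg divide_nonneg_nonneg add_nonneg_nonneg) auto
  have "T 0 \<le> (\<Sum>k=0..p-1. T k)"
    by (rule member_le_sum) (auto intro: T)
  moreover have "1 < T 0"
    using c[of 0] by (simp add: T_def power2_eq_square)
  moreover have "0 \<le> (\<Sum>k=1..p-1. (real k + 1) * (1/2) ^ k)"
    by (intro sum_nonneg) auto
  ultimately show ?thesis
    unfolding rho_fun_def T_def[symmetric] by linarith
qed

lemma rho_fun_ex1_root: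
  assumes c: "\<And>k. k \<le> p - 1 \<Longrightarrow> 1 < M k - 1 / M k"
  shows "\<exists>!\<rho>. \<rho> \<in> {0<..<1} \<and> rho_fun p M \<rho> = 0"
proof -
  have "continuous_on {0..1/2} (rho_fun p M)"
    unfolding rho_fun_def by (intro continuous_intros) auto
  then obtain \<rho> where \<rho>: "0 \<le> \<rho>" "\<rho> \<le> 1/2" "rho_fun p M \<rho> = 0"
    using IVT2'[of "rho_fun p M" "1/2" 0 0] rho_fun_0[of p M] rho_fun_half_neg[of p M] c by auto
  have "\<rho> \<noteq> 0"
    using \<rho> rho_fun_0[of p M] by auto
  with \<rho> have \<rho>01: "\<rho> \<in> {0<..<1}"
    by auto
  have "x = y" if "x \<in> {0<..<1}" "rho_fun p M x = 0" "y \<in> {0<..<1}" "rho_fun p M y = 0" for x y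
    using that c rho_fun_strict_antimono[of p M x y] rho_fun_strict_antimono[of p M y x]
    by (cases x y rule: linorder_cases) (force dest: less_trans[OF zero_less_one])+
  with \<rho> \<rho>01 show ?thesis
    by blast
qed

text \<open>Gives \<open>\<sigma>\<^sub>3 > 0\<close>, since the left side is \<open>0\<close> at a
  root of \<open>rho_fun\<close>. Each subtracted term of \<open>sigma_fun\<close> is at most
  \<open>r\<close> times its counterpart in \<open>rho_fun\<close>.\<close>

lemma sigma_fun_gt:
  assumes c: "\<And>k. k \<le> p - 1 \<Longrightarrow> 0 < M k - 1 / M k" and r: "0 < r" "r < 1"
  shows "r * rho_fun p M r < sigma_fun p M r"
proof -
  have "(M k - 1 / M k) * (r ^ (k+2) / (1 - r))
      < r * ((M k - 1 / M k) * (r ^ (k+1) * (2 - r + real k * (1 - r)) / (1 - r)\<^sup>2))"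
    if k: "k \<le> p - 1" for k
  proof -
    have "1 / (1 - r) \<le> (real k + 1) / (1 - r)" "0 < 1 / (1 - r)\<^sup>2"
      using r by (auto intro: divide_right_mono)
    then have "r ^ (k+2) * (1 / (1 - r)) < r ^ (k+2) * (1 / (1 - r)\<^sup>2 + (real k + 1) / (1 - r))"
      using r by (intro mult_strict_left_mono) (linarith, simp)
    then have "(M k - 1 / M k) * (r ^ (k+2) * (1 / (1 - r)))
        < (M k - 1 / M k) * (r ^ (k+2) * (1 / (1 - r)\<^sup>2 + (real k + 1) / (1 - r)))"
      using c[OF k] by (rule mult_strict_left_mono)
    then show ?thesis
      using r by (subst distortion_factor_eq) (simp_all add: mult_ac)
  qed
  then have "(\<Sum>k=0..p-1. (M k - 1 / M k) * (r ^ (k+2) / (1 - r)))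
      < (\<Sum>k=0..p-1. r * ((M k - 1 / M k) * (r ^ (k+1) * (2 - r + real k * (1 - r)) / (1 - r)\<^sup>2)))"
    by (intro sum_strict_mono) auto
  moreover have "(\<Sum>k=1..p-1. r ^ (k+1)) \<le> (\<Sum>k=1..p-1. r * ((real k + 1) * r ^ k))"
    using r by (intro sum_mono) (simp add: algebra_simps)
  ultimately show ?thesis
    unfolding rho_fun_def sigma_fun_def using r
    by (simp only: right_diff_distrib sum_distrib_left sum_power_Suc_from_1[symmetric])
qed

section \<open>Univalence and covering for the log-\<open>p\<close>-analytic product\<close>

theorem theorem7:
  fixes p :: nat
    and Mstar M :: "nat \<Rightarrow> real"
    and a :: "nat \<Rightarrow> complex \<Rightarrow> complex"
    and f :: "complex \<Rightarrow> complex"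
  assumes "p \<ge> 1"
    and "\<And>k. k \<le> p - 1 \<Longrightarrow> Mstar k > 1"
    and "\<And>z. z \<in> ball 0 1 \<Longrightarrow> f z = (\<Prod>k=0..p-1. a k z powr (cnj z ^ k))"
    and "log_poly_analytic_on p f (ball 0 1)"
    and "f 0 = 1" and "lambda_min f 0 = 1"
    and "\<And>k. k \<le> p - 1 \<Longrightarrow> log_analytic_on (a k) (ball 0 1)"
    and "\<And>k. k \<le> p - 1 \<Longrightarrow> a k 0 = 1"
    and "\<And>k. k \<le> p - 1 \<Longrightarrow> deriv (a k) 0 = 1"
    and "\<And>k z. k \<le> p - 1 \<Longrightarrow> z \<in> ball 0 1 \<Longrightarrow> norm (a k z) \<le> Mstar k"
    and "\<And>k. k \<le> p - 1 \<Longrightarrow> M k = ln (Mstar k) + pi"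
  shows "(\<exists>!\<rho>. \<rho> \<in> {0<..<1} \<and> rho_fun p M \<rho> = 0) \<and>
         (\<forall>\<rho>\<^sub>3 \<sigma>\<^sub>3. \<rho>\<^sub>3 \<in> {0<..<1} \<and> rho_fun p M \<rho>\<^sub>3 = 0 \<and> \<sigma>\<^sub>3 = sigma_fun p M \<rho>\<^sub>3 \<longrightarrow>
            inj_on f (ball 0 \<rho>\<^sub>3) \<and>
            contains_schlicht_disk f (ball 0 \<rho>\<^sub>3) (complex_of_real (cosh \<sigma>\<^sub>3)) (sinh \<sigma>\<^sub>3))"
proof -
  define A where "A k z = Ln (a k z)" for k z
  define F where "F = (\<lambda>z. \<Sum>k=0..p-1. cnj z ^ k * A k z)"
  have nz: "a k z \<noteq> 0" if "k \<le> p - 1" "z \<in> ball 0 1" for k z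
    using assms(7)[OF that(1)] that(2) by (auto simp: log_analytic_on_def log_poly_analytic_on_def)
  have hol: "A k holomorphic_on ball 0 1" if "k \<le> p - 1" for k
    unfolding A_def[abs_def] by (rule log_analytic_on_imp_holomorphic_Ln[OF assms(7)[OF that]])
  have A0: "A k 0 = 0" if "k \<le> p - 1" for k
    using assms(8)[OF that] by (simp add: A_def)
  have A1: "deriv (A k) 0 = 1" if k: "k \<le> p - 1" for k
  proof -
    have "(A k has_field_derivative deriv (A k) 0) (at 0)"
      using hol[OF k] by (intro holomorphic_derivI[of _ "ball 0 1"]) auto
    \<comment> \<open>As \<open>exp (A k 0) = 1\<close>, the chain rule carries the derivative of
      \<open>A k\<close> over to \<open>a k\<close>. This also proves \<open>a k\<close>
      differentiable at \<open>0\<close>, without which the value of \<open>deriv (a k) 0\<close>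
      would say nothing.\<close>
    then have "((\<lambda>z. exp (A k z)) has_field_derivative deriv (A k) 0) (at 0)"
      using A0[OF k] by (auto intro!: derivative_eq_intros)
    moreover have "exp (A k z) = a k z" if "z \<in> ball 0 1" for z
      using nz[OF k that] by (simp add: A_def)
    ultimately have "(a k has_field_derivative deriv (A k) 0) (at 0)"
      by (elim has_field_derivative_transform_within_open[of _ _ _ "ball 0 1"]) auto
    then show ?thesis
      using assms(9)[OF k] DERIV_imp_deriv by fastforce
  qed
  have coeff: "norm ((deriv ^^ n) (A k) 0 / fact n) \<le> M k - 1 / M k"
    if k: "k \<le> p - 1" and n: "n \<ge> 2" for k n
    unfolding assms(11)[OF k]
  proof (rule Taylor_coeff_half_strip)
    fix z :: complex assume z: "z \<in> ball 0 1"
    show "Re (A k z) \<le> ln (Mstar k)"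
      using nz[OF k z] assms(2)[OF k] assms(10)[OF k z] by (simp add: A_def)
    show "\<bar>Im (A k z)\<bar> \<le> pi"
      using nz[OF k z] mpi_less_Im_Ln[of "a k z"] Im_Ln_le_pi[of "a k z"] by (simp add: A_def abs_le_iff)
  qed (use hol[OF k] A0[OF k] assms(2)[OF k] n in auto)
  have c: "1 < M k - 1 / M k" if k: "k \<le> p - 1" for k
  proof -
    have "0 < ln (Mstar k)"
      using assms(2)[OF k] by simp
    then have "3 < M k"
      using assms(11)[OF k] pi_gt3 by linarith
    moreover from this have "1 / M k \<le> 1"
      by simp
    ultimately show ?thesis
      by linarith
  qed
  then have c0: "0 < M k - 1 / M k" if "k \<le> p - 1" for k
    using that by force
  \<comment> \<open>\<open>powr\<close> is the exponential of \<open>cnj z ^ k * Ln (a k z)\<close>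
    only for a nonzero base, hence \<open>nz\<close>.\<close>
  have fF: "f z = exp (F z)" if z: "z \<in> ball 0 1" for z
    using z nz by (simp add: assms(3) F_def A_def exp_sum powr_def)
  have contF: "continuous_on (ball 0 1) F"
    unfolding F_def using hol by (intro continuous_intros holomorphic_on_imp_continuous_on) auto
  have F0: "F 0 = 0"
    using A0 by (simp add: F_def)
  have LnF: "F z = Ln (f z)" if z: "z \<in> ball 0 1" for z
  proof (rule exp_eq_imp_eq_on_connected[where g = F and h = "\<lambda>z. Ln (f z)" and S = "ball 0 1" and a = 0])
    show "continuous_on (ball 0 1) (\<lambda>z. Ln (f z))"
      using assms(4) by (simp add: log_poly_analytic_on_def poly_analytic_on_def)
  qed (use contF F0 z assms(5) in \<open>auto simp: fF\<close>)
  have distortion: "rho_fun p M R * norm (z - w) \<le> norm (F z - F w)"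
    if "norm z \<le> R" "norm w \<le> R" "R < 1" for z w R
    unfolding F_def by (rule poly_analytic_distortion[OF hol A0 A1 coeff that])
  have growth: "sigma_fun p M (norm z) \<le> norm (F z)" if "norm z < 1" for z
    unfolding F_def by (rule poly_analytic_growth[OF hol A0 A1 coeff that])
  have "inj_on f (ball 0 \<rho>) \<and>
      contains_schlicht_disk f (ball 0 \<rho>) (complex_of_real (cosh \<sigma>)) (sinh \<sigma>)"
    if \<rho>: "\<rho> \<in> {0<..<1}" "rho_fun p M \<rho> = 0" and \<sigma>: "\<sigma> = sigma_fun p M \<rho>" for \<rho> \<sigma>
  proof -
    have sub: "ball 0 \<rho> \<subseteq> ball (0::complex) 1" "cball 0 \<rho> \<subseteq> ball (0::complex) 1"
      using \<rho> by auto
    have injF: "inj_on F (ball 0 \<rho>)"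
    proof (rule inj_onI)
      fix z w assume zw: "z \<in> ball 0 \<rho>" "w \<in> ball 0 \<rho>" "F z = F w"
      \<comment> \<open>The distortion factor vanishes at \<open>\<rho>\<close> itself, but both
        points lie in a closed disk of radius \<open>R < \<rho>\<close>, where it is
        positive.\<close>
      define R where "R = max (norm z) (norm w)"
      have R: "0 \<le> R" "R < \<rho>"
        using zw by (auto simp: R_def le_max_iff_disj)
      have "0 < rho_fun p M R"
        using rho_fun_strict_antimono[of p M R \<rho>, OF c0] R \<rho> by simp
      moreover have "rho_fun p M R * norm (z - w) \<le> norm (F z - F w)"
        using R \<rho> by (intro distortion) (auto simp: R_def)
      ultimately show "z = w"
        using zw(3) by (simp add: mult_le_0_iff)
    qed
    have injf: "inj_on f (ball 0 \<rho>)"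
      using injF sub(1) by (metis (no_types, lifting) LnF inj_on_def subsetD)
    have "\<sigma> > 0"
      using sigma_fun_gt[of p M \<rho>, OF c0] \<rho> \<sigma> by simp
    have "ball 0 \<sigma> \<subseteq> F ` ball 0 \<rho>"
    proof (rule ball_subset_image_ball)
      fix z :: complex assume "norm z = \<rho>"
      then show "\<sigma> \<le> norm (F z)"
        using growth[of z] \<rho> \<sigma> by auto
    qed (use contF sub injF F0 \<rho> \<open>\<sigma> > 0\<close> in \<open>auto intro: continuous_on_subset\<close>)
    then have "exp ` ball 0 \<sigma> \<subseteq> exp ` F ` ball 0 \<rho>"
      by (rule image_mono)
    also have "exp ` F ` ball 0 \<rho> = f ` ball 0 \<rho>"
      unfolding image_image using sub(1) by (intro image_cong) (auto simp: fF)
    finally have "ball (complex_of_real (cosh \<sigma>)) (sinh \<sigma>) \<subseteq> f ` ball 0 \<rho>"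
      using ball_cosh_sinh_subset_exp_ball[of \<sigma>] \<open>\<sigma> > 0\<close> by auto
    moreover have "continuous_on (ball 0 \<rho>) f"
    proof -
      have "continuous_on (ball 0 \<rho>) (\<lambda>z. exp (F z))"
        using contF sub(1) by (auto intro!: continuous_on_exp intro: continuous_on_subset)
      then show ?thesis
        by (rule continuous_on_eq) (use sub(1) fF in auto)
    qed
    ultimately show ?thesis
      using injf \<open>\<sigma> > 0\<close> by (auto intro!: contains_schlicht_disk_of_subset_image)
  qed
  then show ?thesis
    using rho_fun_ex1_root[of p M, OF c] by blast
qed

end
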